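(* Consider the adjacency-list model augmented with $\texttt{ADJ}$ (and without $\texttt{JUMP}$ and $\texttt{IN-SORTED}$). For any $n$ and $m$ with $n\le m\le n^2$ and any $\delta\in(0,1]$, there exists a directed graph $G=(V,E)$ with $\Theta(n)$ nodes and $\Theta(m)$ edges such that for any algorithm solving the single-target problem, the expected running time on $G$ with approximation threshold $\delta$, averaged over all targets $t\in V$, is $\Omega(\min\{m,d/\delta\})$, where $d=m/n$.
   Context: Fix a constant $\alpha\in(0,1)$. For a directed graph $G=(V,E)$, an $\alpha$-discounted random walk from $s$: at each step, with probability $\alpha$ it terminates at the current node, otherwise it moves to a uniformly random out-neighbor of the current node. $\pi(s,t)$ is the probability that such a walk from $s$ terminates at $t$. Adjacency-list model: an algorithm accesses $G$ only through constant-time queries $\texttt{DEG-IN}(u)$, $\texttt{DEG-OUT}(u)$ (in-/out-degree of $u$), $\texttt{IN}(u,i)$, $\texttt{OUT}(u,i)$ ($i$-th in-/out-neighbor of $u$); additionally $\texttt{ADJ}(u,v)$ returns whether $(u,v)\in E$. Single-target problem: given $G$ (via queries), a target $t\in V$ and $\delta\in(0,1]$, output estimates $\hat\pi(s,t)$ for all $s\in V$ such that for each $s$, $\Pr\{|\hat\pi(s,t)-\pi(s,t)|\ge\varepsilon\max\{\pi(s,t),\delta\}\}\le p_f$, where $\varepsilon,p_f$ are fixed small constants; an algorithm solves the problem if this holds for every input. *)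

theory Defs
  imports "HOL-Probability.Probability" "Graph_Theory.Pair_Digraph"
begin

(* A uniformly random out-neighbour must exist at every node, so graphs with a node of
   out-degree 0 are excluded.  Loops are allowed; there are no parallel edges. *)
definition walk_digraph :: "nat pair_pre_digraph \<Rightarrow> bool" where
  "walk_digraph G \<longleftrightarrow>
     pair_fin_digraph G \<and> pverts G \<noteq> {} \<and> (\<forall>u\<in>pverts G. \<exists>v. (u, v) \<in> parcs G)"

partial_function (spmf) discounted_walk ::
  "real \<Rightarrow> nat pair_pre_digraph \<Rightarrow> nat \<Rightarrow> nat spmf" where
  "discounted_walk \<alpha> G u =
     bind_pmf (bernoulli_pmf \<alpha>) (\<lambda>stop.
       if stop then return_spmf u
       else bind_pmf (pmf_of_set {v. (u, v) \<in> parcs G}) (\<lambda>v. discounted_walk \<alpha> G v))"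

definition ppr :: "real \<Rightarrow> nat pair_pre_digraph \<Rightarrow> nat \<Rightarrow> nat \<Rightarrow> real" where
  "ppr \<alpha> G s t = spmf (discounted_walk \<alpha> G s) t"

record adj_lists =
  out_list :: "nat \<Rightarrow> nat list"
  in_list :: "nat \<Rightarrow> nat list"

definition adj_lists_of :: "adj_lists \<Rightarrow> nat pair_pre_digraph \<Rightarrow> bool" where
  "adj_lists_of L G \<longleftrightarrow> (\<forall>u\<in>pverts G.
     distinct (out_list L u) \<and> set (out_list L u) = {v. (u, v) \<in> parcs G} \<and>
     distinct (in_list L u) \<and> set (in_list L u) = {v. (v, u) \<in> parcs G})"

datatype query =
    DEG_IN nat
  | DEG_OUT nat
  | IN nat nat
  | OUT nat nat
  | ADJ nat nat

fun query_nodes :: "query \<Rightarrow> nat set" where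
  "query_nodes (DEG_IN u) = {u}"
| "query_nodes (DEG_OUT u) = {u}"
| "query_nodes (IN u i) = {u}"
| "query_nodes (OUT u i) = {u}"
| "query_nodes (ADJ u v) = {u, v}"

datatype reply =
    Number nat
  | Node nat
  | Truth bool
  | Undefined

(* Neighbours are numbered from 1. *)
fun graph_reply :: "adj_lists \<Rightarrow> query \<Rightarrow> reply" where
  "graph_reply L (DEG_IN u) = Number (length (in_list L u))"
| "graph_reply L (DEG_OUT u) = Number (length (out_list L u))"
| "graph_reply L (IN u i) =
     (if 1 \<le> i \<and> i \<le> length (in_list L u) then Node (in_list L u ! (i - 1)) else Undefined)"
| "graph_reply L (OUT u i) =
     (if 1 \<le> i \<and> i \<le> length (out_list L u) then Node (out_list L u ! (i - 1)) else Undefined)"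
| "graph_reply L (ADJ u v) = Truth (v \<in> set (out_list L u))"

datatype event = Replied reply | Drawn nat

(* Between two queries an algorithm may draw from any discrete distribution; the drawn
   value becomes part of the transcript. *)
datatype action =
    Ask query
  | Draw "nat pmf"
  | Output "nat \<Rightarrow> real"

(* An algorithm chooses its next action from its input and the transcript so far, without any
   computability restriction.  Its input consists of the node set, the number of edges, the
   target and the threshold; everything else about the graph has to be learned by queries. *)
type_synonym algorithm = "nat set \<Rightarrow> nat \<Rightarrow> nat \<Rightarrow> real \<Rightarrow> event list \<Rightarrow> action"

definition discovered :: "nat \<Rightarrow> event list \<Rightarrow> nat set" where
  "discovered t h = insert t {v. Replied (Node v) \<in> set h}"

(* In the absence of JUMP, nodes become accessible only as the target or as the reply to an
   earlier query; queries about other nodes reveal nothing. *)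
definition answer :: "adj_lists \<Rightarrow> nat \<Rightarrow> event list \<Rightarrow> query \<Rightarrow> reply" where
  "answer L t h q = (if query_nodes q \<subseteq> discovered t h then graph_reply L q else Undefined)"

(* The mass missing from the resulting subdistribution is the probability of running forever. *)
partial_function (spmf) run_from ::
  "adj_lists \<Rightarrow> nat \<Rightarrow> (event list \<Rightarrow> action) \<Rightarrow> event list \<Rightarrow> ((nat \<Rightarrow> real) \<times> event list) spmf"
  where
  "run_from L t A h =
     (case A h of
        Ask q \<Rightarrow> run_from L t A (h @ [Replied (answer L t h q)])
      | Draw D \<Rightarrow> bind_pmf D (\<lambda>x. run_from L t A (h @ [Drawn x]))
      | Output f \<Rightarrow> return_spmf (f, h))"

definition run ::
  "algorithm \<Rightarrow> nat pair_pre_digraph \<Rightarrow> adj_lists \<Rightarrow> nat \<Rightarrow> real \<Rightarrow>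
     ((nat \<Rightarrow> real) \<times> event list) spmf" where
  "run A G L t \<delta> = run_from L t (A (pverts G) (card (parcs G)) t \<delta>) []"

definition num_queries :: "event list \<Rightarrow> nat" where
  "num_queries h = length (filter (\<lambda>e. \<exists>r. e = Replied r) h)"

(* Every query costs one unit of time; draws and internal computation are free. *)
definition expected_time ::
  "algorithm \<Rightarrow> nat pair_pre_digraph \<Rightarrow> adj_lists \<Rightarrow> nat \<Rightarrow> real \<Rightarrow> ennreal" where
  "expected_time A G L t \<delta> =
     (if lossless_spmf (run A G L t \<delta>)
      then \<integral>\<^sup>+ (f, h). of_nat (num_queries h) \<partial>measure_spmf (run A G L t \<delta>)
      else \<infinity>)"

(* Not terminating counts as failure. *)
definition solves_single_target :: "real \<Rightarrow> real \<Rightarrow> real \<Rightarrow> algorithm \<Rightarrow> bool" where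
  "solves_single_target \<alpha> \<epsilon> p A \<longleftrightarrow>
     (\<forall>G L t \<delta>. walk_digraph G \<and> adj_lists_of L G \<and> t \<in> pverts G \<and> 0 < \<delta> \<and> \<delta> \<le> 1 \<longrightarrow>
        (\<forall>s\<in>pverts G.
           measure_pmf.prob (run A G L t \<delta>)
             {r. case r of
                   None \<Rightarrow> True
                 | Some (f, h) \<Rightarrow> \<bar>f s - ppr \<alpha> G s t\<bar> \<ge> \<epsilon> * max (ppr \<alpha> G s t) \<delta>} \<le> p))"

end

theory Submission
  imports Defs
begin

text \<open>
  The graph contains an arc \<open>(s, z)\<close> in a component that cannot be reached from the target \<open>t\<close>, even
  backwards, so \<open>\<pi>(s, t) = 0\<close>, and a set \<open>E\<close> of about \<open>min {m, d / \<delta>}\<close> arcs whose heads reach \<open>t\<close> with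
  probability of order \<open>\<delta>\<close>. Replacing \<open>(u, w) \<in> E\<close> and \<open>(s, z)\<close> by \<open>(u, z)\<close> and \<open>(s, w)\<close> keeps all
  degrees but raises \<open>\<pi>(s, t)\<close> to order \<open>\<delta>\<close>, so a correct algorithm must notice the swap with
  probability at least \<open>1 - 2 p\<close>. A single query notices the swap of at most one arc of \<open>E\<close>: the arc
  that it reads off an adjacency list or tests. Hence the expected number of queries is at least
  \<open>(1 - 2 p) * card E\<close>.
\<close>

section \<open>One-step equations and bounds for \<open>ppr\<close>\<close>

lemma ppr_unfold:
  assumes "0 \<le> \<alpha>" "\<alpha> \<le> 1" and fin: "finite {v. (u, v) \<in> parcs G}" and ne: "{v. (u, v) \<in> parcs G} \<noteq> {}"
  shows "ppr \<alpha> G u t =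
    \<alpha> * indicator {u} t + (1 - \<alpha>) * ((\<Sum>v | (u, v) \<in> parcs G. ppr \<alpha> G v t) / card {v. (u, v) \<in> parcs G})"
proof -
  have "ppr \<alpha> G u t = spmf (return_spmf u) t * \<alpha> +
      spmf (bind_pmf (pmf_of_set {v. (u, v) \<in> parcs G}) (discounted_walk \<alpha> G)) t * (1 - \<alpha>)"
    unfolding ppr_def by (subst discounted_walk.simps) (simp add: pmf_bind assms)
  then show ?thesis
    by (simp add: pmf_bind integral_pmf_of_set[OF ne fin] ppr_def indicator_def
      algebra_simps)
qed

lemma ppr_nonneg: "0 \<le> ppr \<alpha> G u t"
  by (simp add: ppr_def)

lemma ppr_self_ge:
  assumes "0 \<le> \<alpha>" "\<alpha> \<le> 1" "finite {v. (t, v) \<in> parcs G}" "{v. (t, v) \<in> parcs G} \<noteq> {}"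
  shows "\<alpha> \<le> ppr \<alpha> G t t"
  using assms by (subst ppr_unfold) (auto intro!: mult_nonneg_nonneg divide_nonneg_nonneg sum_nonneg ppr_nonneg)

lemma ppr_step_ge:
  assumes "0 \<le> \<alpha>" "\<alpha> \<le> 1" "finite {v. (u, v) \<in> parcs G}" "(u, v) \<in> parcs G"
  shows "(1 - \<alpha>) * (ppr \<alpha> G v t / card {v. (u, v) \<in> parcs G}) \<le> ppr \<alpha> G u t"
proof -
  let ?N = "{v. (u, v) \<in> parcs G}"
  have "ppr \<alpha> G v t \<le> (\<Sum>v\<in>?N. ppr \<alpha> G v t)"
    using assms by (intro member_le_sum) (auto simp: ppr_nonneg)
  then have "(1 - \<alpha>) * (ppr \<alpha> G v t / card ?N) \<le> (1 - \<alpha>) * ((\<Sum>v\<in>?N. ppr \<alpha> G v t) / card ?N)"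
    using assms by (intro mult_left_mono divide_right_mono) auto
  also have "\<dots> \<le> ppr \<alpha> G u t"
    using assms by (subst ppr_unfold) auto
  finally show ?thesis .
qed

lemma ppr_single_out:
  assumes "0 \<le> \<alpha>" "\<alpha> \<le> 1" "{v. (u, v) \<in> parcs G} = {v}" "u \<noteq> t"
  shows "ppr \<alpha> G u t = (1 - \<alpha>) * ppr \<alpha> G v t"
  using assms by (subst ppr_unfold) auto

section \<open>Transcripts of runs, and runs on two inputs that look alike\<close>

text \<open>Over-approximates the events that a run can append: a reply has to be the true one,
  while a drawn value is left arbitrary, since only replies carry information about the
  graph.\<close>

definition valid_step :: "adj_lists \<Rightarrow> nat \<Rightarrow> (event list \<Rightarrow> action) \<Rightarrow> event list \<Rightarrow> nat \<Rightarrow> bool" where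
  "valid_step L t A h i \<longleftrightarrow>
     (case A (take i h) of
        Ask q \<Rightarrow> h ! i = Replied (answer L t (take i h) q)
      | Draw D \<Rightarrow> \<exists>x. h ! i = Drawn x
      | Output f \<Rightarrow> False)"

text \<open>Fixed-point induction over all arguments of \<open>run_from\<close> at once. Each
  unfolding appends one event \<open>e\<close>, and \<open>step\<close> turns the claim for
  \<open>h\<^sub>0 @ [e]\<close> into the claim for \<open>h\<^sub>0\<close>.\<close>

lemma set_spmf_run_from:
  "\<forall>(f, h) \<in> set_spmf (run_from L t A h\<^sub>0).
     take (length h\<^sub>0) h = h\<^sub>0 \<and> (\<forall>i. length h\<^sub>0 \<le> i \<and> i < length h \<longrightarrow> valid_step L t A h i)"
proof -
  define S where "S L t A h\<^sub>0 = {(f :: nat \<Rightarrow> real, h). take (length h\<^sub>0) h = h\<^sub>0 \<and>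
     (\<forall>i. length h\<^sub>0 \<le> i \<and> i < length h \<longrightarrow> valid_step L t A h i)}"
    for L t A and h\<^sub>0 :: "event list"
  have step: "x \<in> S L t A h\<^sub>0"
    if "x \<in> S L t A (h\<^sub>0 @ [e])"
      and "case A h\<^sub>0 of Ask q \<Rightarrow> e = Replied (answer L t h\<^sub>0 q) | Draw D \<Rightarrow> \<exists>x. e = Drawn x | Output f \<Rightarrow> False"
    for x L t A e h\<^sub>0
  proof (cases x)
    case (Pair f h)
    have *: "take (Suc (length h\<^sub>0)) h = h\<^sub>0 @ [e]"
      and vs: "\<And>i. Suc (length h\<^sub>0) \<le> i \<Longrightarrow> i < length h \<Longrightarrow> valid_step L t A h i"
      using that(1) by (auto simp: S_def Pair)
    have len: "length h\<^sub>0 < length h"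
      using arg_cong[OF *, of length] by simp
    have tk: "take (length h\<^sub>0) h = h\<^sub>0" and nth: "h ! length h\<^sub>0 = e"
      using * len by (simp_all add: take_Suc_conv_app_nth)
    have "valid_step L t A h (length h\<^sub>0)"
      using that(2) unfolding valid_step_def tk nth .
    then have "valid_step L t A h i" if "length h\<^sub>0 \<le> i" "i < length h" for i
      using vs[of i] that by (cases "i = length h\<^sub>0") auto
    then show ?thesis by (simp add: S_def Pair tk)
  qed
  have "\<forall>L t A h\<^sub>0. set_spmf (run_from L t A h\<^sub>0) \<subseteq> S L t A h\<^sub>0"
  proof (induction rule: run_from.fixp_induct)
    case 1
    \<comment> \<open>Admissibility: the support of the limit of a chain is the union of the
      supports, so an upper bound on supports passes to the limit.\<close>
    show ?case
    proof (rule ccpo.admissibleI, intro allI)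
      fix C L t A h\<^sub>0
      assume ch: "Complete_Partial_Order.chain (fun_ord (ord_spmf (=))) C" and "C \<noteq> {}"
        and IH: "\<forall>F\<in>C. \<forall>L t A h\<^sub>0. set_spmf (curry (curry (curry F)) L t A h\<^sub>0) \<subseteq> S L t A h\<^sub>0"
      show "set_spmf (curry (curry (curry (fun_lub lub_spmf C))) L t A h\<^sub>0) \<subseteq> S L t A h\<^sub>0"
      proof
        fix x assume "x \<in> set_spmf (curry (curry (curry (fun_lub lub_spmf C))) L t A h\<^sub>0)"
        then obtain F where "F \<in> C" "x \<in> set_spmf (curry (curry (curry F)) L t A h\<^sub>0)"
          by (auto simp: fun_lub_def set_lub_spmf[OF chain_fun[OF ch]])
        then show "x \<in> S L t A h\<^sub>0" using IH by blast
      qed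
    qed
  next
    case 2
    show ?case by simp
  next
    case (3 F)
    show ?case
    proof (intro allI subsetI)
      fix L t A h\<^sub>0 x
      assume x: "x \<in> set_spmf (case A h\<^sub>0 of Ask q \<Rightarrow> F L t A (h\<^sub>0 @ [Replied (answer L t h\<^sub>0 q)])
              | Draw D \<Rightarrow> D \<bind> (\<lambda>x. F L t A (h\<^sub>0 @ [Drawn x]))
              | Output f \<Rightarrow> return_spmf (f, h\<^sub>0))"
      show "x \<in> S L t A h\<^sub>0"
      proof (cases "A h\<^sub>0")
        case (Ask q)
        then have "x \<in> set_spmf (F L t A (h\<^sub>0 @ [Replied (answer L t h\<^sub>0 q)]))"
          using x by simp
        then have "x \<in> S L t A (h\<^sub>0 @ [Replied (answer L t h\<^sub>0 q)])"
          using 3 by blast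
        then show ?thesis by (rule step) (simp add: Ask)
      next
        case (Draw D)
        then obtain y where "x \<in> set_spmf (F L t A (h\<^sub>0 @ [Drawn y]))"
          using x by (auto simp: set_spmf_bind_pmf Set.bind_def)
        then have "x \<in> S L t A (h\<^sub>0 @ [Drawn y])"
          using 3 by blast
        then show ?thesis by (rule step) (simp add: Draw)
      next
        case (Output f)
        then show ?thesis using x by (auto simp: S_def)
      qed
    qed
  qed
  then show ?thesis by (fastforce simp: S_def)
qed

lemma spmf_run_from_eq_0:
  assumes "take (length h\<^sub>0) h \<noteq> h\<^sub>0"
  shows "spmf (run_from L t A h\<^sub>0) (f, h) = 0"
  using assms set_spmf_run_from[of L t A h\<^sub>0] by (auto simp: spmf_eq_0_set_spmf)

text \<open>Both inputs are consulted along the same transcript \<open>h\<close>: the question is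
  whether \<open>h\<close>, typically produced on \<open>L\<close>, contains a query to which
  \<open>L'\<close> would have replied differently.\<close>

definition distinguishes ::
  "adj_lists \<Rightarrow> adj_lists \<Rightarrow> nat \<Rightarrow> (event list \<Rightarrow> action) \<Rightarrow> event list \<Rightarrow> bool" where
  "distinguishes L L' t A h \<longleftrightarrow>
     (\<exists>i<length h. \<exists>q. A (take i h) = Ask q \<and> answer L t (take i h) q \<noteq> answer L' t (take i h) q)"

text \<open>The probability of ending with a fixed transcript is determined by the draws along it,
  as long as the replies in it are consistent with the input. Without a distinguishing query both
  inputs are treated alike. The induction is on the number of events still to come.\<close>

lemma spmf_run_from_cong:
  assumes "\<not> distinguishes L L' t A h"
  shows "spmf (run_from L t A h\<^sub>0) (f, h) = spmf (run_from L' t A h\<^sub>0) (f, h)"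
\<comment> \<open>Because of \<open>Suc\<close>, the base case is a history longer than
  \<open>h\<close>, where both sides vanish; \<open>h\<^sub>0 = h\<close> still falls under the
  induction step.\<close>
proof (induction "Suc (length h) - length h\<^sub>0" arbitrary: h\<^sub>0)
  case 0
  then have "take (length h\<^sub>0) h \<noteq> h\<^sub>0"
    using arg_cong[of _ _ length] by fastforce
  then show ?case by (simp add: spmf_run_from_eq_0)
next
  case (Suc k)
  have IH: "spmf (run_from L t A (h\<^sub>0 @ [e])) (f, h) = spmf (run_from L' t A (h\<^sub>0 @ [e])) (f, h)" for e
    using Suc.hyps(2) by (intro Suc.hyps(1)) auto
  show ?case
  proof (cases "take (length h\<^sub>0) h = h\<^sub>0 \<and> h \<noteq> h\<^sub>0")
    case True
    then have len: "length h\<^sub>0 < length h"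
      by (metis le_less_linear take_all)
    show ?thesis
    proof (cases "A h\<^sub>0")
      case (Ask q)
      have "answer L t h\<^sub>0 q = answer L' t h\<^sub>0 q"
        using assms True len Ask unfolding distinguishes_def by metis
      then show ?thesis
        using IH by (simp add: run_from.simps[of _ _ _ h\<^sub>0] Ask)
    next
      case (Draw D)
      then show ?thesis
        using IH by (simp add: run_from.simps[of _ _ _ h\<^sub>0] pmf_bind)
    next
      case (Output g)
      then show ?thesis
        by (simp add: run_from.simps[of _ _ _ h\<^sub>0])
    qed
  next
    case False
    then consider "take (length h\<^sub>0) h \<noteq> h\<^sub>0" | "h = h\<^sub>0" by blast
    then show ?thesis
    proof cases
      case 1
      then show ?thesis by (simp add: spmf_run_from_eq_0)
    next
      case 2
      \<comment> \<open>Asking or drawing extends the history beyond \<open>h\<close>, so such a run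
        cannot end in \<open>h\<close>. There remains \<open>Output\<close>, which consults no
        adjacency list.\<close>
      then have ze: "spmf (run_from L t A (h\<^sub>0 @ [e])) (f, h) = 0" for L e
        by (intro spmf_run_from_eq_0) simp
      show ?thesis
        by (cases "A h\<^sub>0") (simp_all add: run_from.simps[of _ _ _ h\<^sub>0] pmf_bind ze)
    qed
  qed
qed

section \<open>Swapping the heads of two arcs\<close>

definition swap_arcs ::
  "nat pair_pre_digraph \<Rightarrow> nat \<Rightarrow> nat \<Rightarrow> nat \<Rightarrow> nat \<Rightarrow> nat pair_pre_digraph" where
  "swap_arcs G u w s z = G\<lparr>parcs := parcs G - {(u, w), (s, z)} \<union> {(u, z), (s, w)}\<rparr>"

definition rename :: "nat \<Rightarrow> nat \<Rightarrow> nat list \<Rightarrow> nat list" where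
  "rename x y = map (\<lambda>v. if v = x then y else v)"

text \<open>Entries are replaced in place. Hence list lengths and all other positions are preserved,
  and a neighbour query sees the swap only at a replaced entry.\<close>

definition swap_lists :: "adj_lists \<Rightarrow> nat \<Rightarrow> nat \<Rightarrow> nat \<Rightarrow> nat \<Rightarrow> adj_lists" where
  "swap_lists L u w s z =
     \<lparr>out_list = (out_list L)(u := rename w z (out_list L u), s := rename z w (out_list L s)),
      in_list = (in_list L)(w := rename u s (in_list L w), z := rename s u (in_list L z))\<rparr>"

lemma length_rename [simp]: "length (rename x y l) = length l"
  by (simp add: rename_def)

lemma nth_rename: "i < length l \<Longrightarrow> rename x y l ! i = (if l ! i = x then y else l ! i)"
  by (simp add: rename_def)

lemma set_rename: "x \<in> set l \<Longrightarrow> set (rename x y l) = insert y (set l - {x})"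
  by (auto simp: rename_def)

lemma distinct_rename: "distinct l \<Longrightarrow> y \<notin> set l \<Longrightarrow> distinct (rename x y l)"
  by (auto simp: rename_def distinct_map inj_on_def)

lemma pverts_swap_arcs [simp]: "pverts (swap_arcs G u w s z) = pverts G"
  by (simp add: swap_arcs_def)

lemma parcs_swap_arcs:
  "parcs (swap_arcs G u w s z) = parcs G - {(u, w), (s, z)} \<union> {(u, z), (s, w)}"
  by (simp add: swap_arcs_def)

context
  fixes G u w s z
  assumes wd: "walk_digraph G"
    and arcs: "(u, w) \<in> parcs G" "(s, z) \<in> parcs G"
    and fresh: "(u, z) \<notin> parcs G" "(s, w) \<notin> parcs G"
begin

lemma swap_distinct: "u \<noteq> s" "w \<noteq> z"
  using arcs fresh by auto

text \<open>Two arcs are removed and two new ones inserted. The equality matters because the number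
  of arcs is an input of the algorithm and must not give the swap away.\<close>

lemma card_parcs_swap_arcs: "card (parcs (swap_arcs G u w s z)) = card (parcs G)"
proof -
  have "finite (parcs G)"
    using wd by (simp add: walk_digraph_def pair_fin_digraph_def pair_fin_digraph_axioms_def)
  moreover have "card (parcs G) \<ge> card {(u, w), (s, z)}"
    using arcs calculation by (intro card_mono) auto
  ultimately show ?thesis
    using arcs fresh swap_distinct unfolding parcs_swap_arcs
    by (subst card_Un_disjoint) (auto simp: card_Diff_subset)
qed

lemma walk_digraph_swap_arcs: "walk_digraph (swap_arcs G u w s z)"
proof -
  have fin: "pair_fin_digraph G" and out: "\<And>x. x \<in> pverts G \<Longrightarrow> \<exists>v. (x, v) \<in> parcs G"
    and ne: "pverts G \<noteq> {}"
    using wd by (auto simp: walk_digraph_def)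
  have "pair_fin_digraph (swap_arcs G u w s z)"
    using fin arcs
    unfolding pair_fin_digraph_def pair_fin_digraph_axioms_def pair_wf_digraph_def
    by (auto simp: parcs_swap_arcs)
  moreover have "\<exists>v. (x, v) \<in> parcs (swap_arcs G u w s z)" if "x \<in> pverts G" for x
    using out[OF that] by (cases "x = u \<or> x = s") (auto simp: parcs_swap_arcs)
  ultimately show ?thesis
    using ne by (simp add: walk_digraph_def)
qed

lemma adj_lists_of_swap:
  assumes L: "adj_lists_of L G"
  shows "adj_lists_of (swap_lists L u w s z) (swap_arcs G u w s z)"
  unfolding adj_lists_of_def
proof (intro ballI)
  fix x assume "x \<in> pverts (swap_arcs G u w s z)"
  then have x: "distinct (out_list L x)" "set (out_list L x) = {v. (x, v) \<in> parcs G}"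
     "distinct (in_list L x)" "set (in_list L x) = {v. (v, x) \<in> parcs G}"
    using L by (auto simp: adj_lists_of_def)
  note d = swap_distinct
  show "distinct (out_list (swap_lists L u w s z) x) \<and>
    set (out_list (swap_lists L u w s z) x) = {v. (x, v) \<in> parcs (swap_arcs G u w s z)} \<and>
    distinct (in_list (swap_lists L u w s z) x) \<and>
    set (in_list (swap_lists L u w s z) x) = {v. (v, x) \<in> parcs (swap_arcs G u w s z)}"
  proof (intro conjI)
    show "distinct (out_list (swap_lists L u w s z) x)" "distinct (in_list (swap_lists L u w s z) x)"
      using x arcs fresh d by (auto simp: swap_lists_def intro!: distinct_rename)
    show "set (out_list (swap_lists L u w s z) x) = {v. (x, v) \<in> parcs (swap_arcs G u w s z)}"
      "set (in_list (swap_lists L u w s z) x) = {v. (v, x) \<in> parcs (swap_arcs G u w s z)}"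
      using x arcs fresh d by (auto simp: swap_lists_def parcs_swap_arcs set_rename)
  qed
qed

end

section \<open>How many swaps a transcript can detect\<close>

text \<open>The only arc whose swap the query can reveal. Degree queries get an arbitrary value, as
  a swap leaves degrees unchanged.\<close>

fun probed_arc :: "adj_lists \<Rightarrow> query \<Rightarrow> nat \<times> nat" where
  "probed_arc L (IN x i) = (in_list L x ! (i - 1), x)"
| "probed_arc L (OUT x i) = (x, out_list L x ! (i - 1))"
| "probed_arc L (ADJ x y) = (x, y)"
| "probed_arc L _ = undefined"

text \<open>A query cannot usefully name the undiscovered nodes \<open>s\<close> and
  \<open>z\<close>. The changes still visible are the entry \<open>w\<close> in the out-list of
  \<open>u\<close>, the entry \<open>u\<close> in the in-list of \<open>w\<close>, and the truth
  value of \<open>ADJ u w\<close>; all three probe \<open>(u, w)\<close>.\<close>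

lemma swap_detected_imp_probed:
  assumes "s \<notin> discovered t h" "z \<notin> discovered t h"
    and neq: "answer L t h q \<noteq> answer (swap_lists L u w s z) t h q"
  shows "probed_arc L q = (u, w)"
proof -
  have q: "s \<notin> query_nodes q" "z \<notin> query_nodes q"
    and neq': "graph_reply L q \<noteq> graph_reply (swap_lists L u w s z) q"
    using assms by (auto simp: answer_def split: if_splits)
  show ?thesis
  proof (cases q)
    case (ADJ x y)
    then show ?thesis
      using q neq' by (auto simp: swap_lists_def rename_def split: if_splits)
  qed (use q neq' in \<open>auto simp: swap_lists_def nth_rename split: if_splits\<close>)
qed

context
  fixes G :: "nat pair_pre_digraph" and L t X
  assumes wd: "walk_digraph G" and L: "adj_lists_of L G" and t: "t \<in> pverts G" "t \<notin> X"
    and closed: "\<And>x y. (x, y) \<in> parcs G \<Longrightarrow> x \<in> X \<longleftrightarrow> y \<in> X"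
begin

text \<open>By \<open>closed\<close>, \<open>X\<close> is a union of weakly connected components, so
  neither in- nor out-neighbours lead into it.\<close>

lemma graph_reply_avoids:
  assumes "query_nodes q \<subseteq> pverts G - X" "graph_reply L q = Node v"
  shows "v \<in> pverts G - X"
proof -
  have wf: "pair_wf_digraph G"
    using wd by (simp add: walk_digraph_def pair_fin_digraph_def)
  have "\<exists>x\<in>query_nodes q. (x, v) \<in> parcs G \<or> (v, x) \<in> parcs G"
  proof (cases q)
    case (IN x i)
    then have "v \<in> set (in_list L x)" "x \<in> pverts G" using assms by (auto split: if_splits)
    then show ?thesis using IN L by (auto simp: adj_lists_of_def)
  next
    case (OUT x i)
    then have "v \<in> set (out_list L x)" "x \<in> pverts G" using assms by (auto split: if_splits)
    then show ?thesis using OUT L by (auto simp: adj_lists_of_def)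
  qed (use assms in auto)
  then show ?thesis
    using assms(1) closed pair_wf_digraph.in_arcsD1[OF wf] pair_wf_digraph.in_arcsD2[OF wf] by blast
qed

text \<open>Every discovered node other than \<open>t\<close> is the reply to a query about nodes
  discovered earlier, so by induction the exploration never enters the part \<open>X\<close> of the
  graph that misses \<open>t\<close>.\<close>

lemma discovered_avoids:
  assumes "\<And>i. i < length h \<Longrightarrow> valid_step L t A h i" "i \<le> length h"
  shows "discovered t (take i h) \<subseteq> pverts G - X"
  using assms(2)
proof (induction i)
  case 0
  then show ?case using t by (simp add: discovered_def)
next
  case (Suc i)
  have IH: "discovered t (take i h) \<subseteq> pverts G - X" using Suc by simp
  have "v \<in> pverts G - X" if hi: "h ! i = Replied (Node v)" for v
  proof -
    obtain q where "A (take i h) = Ask q" "answer L t (take i h) q = Node v"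
      using assms(1)[of i] Suc.prems hi by (cases "A (take i h)") (auto simp: valid_step_def)
    then show ?thesis
      using IH by (intro graph_reply_avoids[of q]) (auto simp: answer_def split: if_splits)
  qed
  then show ?case
    using IH Suc.prems by (auto simp: discovered_def take_Suc_conv_app_nth)
qed

text \<open>\<open>probed_arc\<close> is computed from the query and \<open>L\<close> alone,
  whichever swap is at issue. Mapping each replied position to its probed arc therefore covers all
  distinguished swaps, and each query pays for at most one of them.\<close>

lemma card_distinguished_swaps_le:
  assumes h: "\<And>i. i < length h \<Longrightarrow> valid_step L t A h i" and sz: "s \<in> X" "z \<in> X"
  shows "card {e \<in> E. distinguishes L (swap_lists L (fst e) (snd e) s z) t A h} \<le> num_queries h"
proof -
  define I where "I = {i. i < length h \<and> (\<exists>r. h ! i = Replied r)}"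
  define a where "a i = probed_arc L (THE q. A (take i h) = Ask q)" for i
  have "e \<in> a ` I" if dist: "distinguishes L (swap_lists L (fst e) (snd e) s z) t A h" for e
  proof -
    obtain i q where i: "i < length h" "A (take i h) = Ask q"
      "answer L t (take i h) q \<noteq> answer (swap_lists L (fst e) (snd e) s z) t (take i h) q"
      using dist unfolding distinguishes_def by blast
    have "discovered t (take i h) \<subseteq> pverts G - X"
      using discovered_avoids[OF h] i(1) by simp
    then have "probed_arc L q = e"
      using swap_detected_imp_probed[OF _ _ i(3)] sz by auto
    then have "a i = e" using i(2) by (simp add: a_def)
    moreover have "i \<in> I" using h[OF i(1)] i by (simp add: I_def valid_step_def)
    ultimately show ?thesis by blast
  qed
  moreover have "finite I" by (simp add: I_def)
  ultimately have "card {e \<in> E. distinguishes L (swap_lists L (fst e) (snd e) s z) t A h} \<le> card I"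
    by (intro surj_card_le[of _ _ a]) auto
  also have "card I = num_queries h"
    by (simp add: I_def num_queries_def length_filter_conv_card)
  finally show ?thesis .
qed

end

section \<open>From correctness to a lower bound on the number of queries\<close>

lemma measure_pmf_cong_on:
  assumes "\<And>x. x \<in> A \<Longrightarrow> pmf p x = pmf q x"
  shows "measure_pmf.prob p A = measure_pmf.prob q A"
  unfolding measure_pmf_conv_infsetsum using assms by (rule infsetsum_cong) simp_all

text \<open>A transcript that does not distinguish the inputs is equally likely on both, but its
  estimate for \<open>s\<close> cannot be right on both. Runs that are right on the original graph
  and do not distinguish have probability at least \<open>1 - p\<close> minus that of
  \<open>D\<close>, and they fail on the swapped graph, so this is at most \<open>p\<close>. Hence
  \<open>D\<close> has probability at least \<open>1 - 2 * p\<close>.\<close>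

lemma prob_distinguishes_swap_ge:
  assumes solves: "solves_single_target \<alpha> \<epsilon> p A" and "0 < \<epsilon>" "\<epsilon> \<le> 1 / 2" "p \<le> 1 / 4"
    and G: "walk_digraph G" "adj_lists_of L G" "t \<in> pverts G" "s \<in> pverts G"
    and \<delta>: "0 < \<delta>" "\<delta> \<le> 1"
    and arcs: "(u, w) \<in> parcs G" "(s, z) \<in> parcs G" "(u, z) \<notin> parcs G" "(s, w) \<notin> parcs G"
    and before: "ppr \<alpha> G s t = 0"
    and after: "4 * \<epsilon> * \<delta> \<le> ppr \<alpha> (swap_arcs G u w s z) s t"
    and lossless: "lossless_spmf (run A G L t \<delta>)"
  shows "1 / 2 \<le> measure (measure_spmf (run A G L t \<delta>))
    {(f, h). distinguishes L (swap_lists L u w s z) t (A (pverts G) (card (parcs G)) t \<delta>) h}"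
proof -
  define G' where "G' = swap_arcs G u w s z"
  define L' where "L' = swap_lists L u w s z"
  define B where "B = A (pverts G) (card (parcs G)) t \<delta>"
  define fails where "fails G = {r :: ((nat \<Rightarrow> real) \<times> event list) option. case r of None \<Rightarrow> True
      | Some (f, h) \<Rightarrow> \<bar>f s - ppr \<alpha> G s t\<bar> \<ge> \<epsilon> * max (ppr \<alpha> G s t) \<delta>}" for G
  define D where "D = {(f :: nat \<Rightarrow> real, h). distinguishes L L' t B h}"
  define good where "good = - (fails G \<union> Some ` D)"
  let ?R = "run A G L t \<delta>" and ?R' = "run A G' L' t \<delta>"
  have R: "?R = run_from L t B []" by (simp add: run_def B_def)
  have R': "?R' = run_from L' t B []"
    by (simp add: run_def B_def G'_def card_parcs_swap_arcs[OF G(1) arcs])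
  have "measure_pmf.prob ?R (fails G) \<le> p"
    using solves G \<delta> unfolding solves_single_target_def fails_def by blast
  then have "measure_pmf.prob ?R (fails G \<union> Some ` D) \<le> p + measure_pmf.prob ?R (Some ` D)"
    using measure_Un_le[of "fails G" "measure_pmf ?R" "Some ` D"] by simp
  then have "1 - p - measure_pmf.prob ?R (Some ` D) \<le> measure_pmf.prob ?R good"
    unfolding good_def
    by (simp add: measure_pmf.prob_compl[of "fails G \<union> Some ` D" ?R, simplified] Compl_eq_Diff_UNIV)
  also have "measure_pmf.prob ?R good = measure_pmf.prob ?R' good"
  proof (rule measure_pmf_cong_on)
    fix x assume x: "x \<in> good"
    then obtain f h where "x = Some (f, h)"
      by (cases x) (auto simp: good_def fails_def)
    moreover from x this have "\<not> distinguishes L L' t B h"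
      by (auto simp: good_def D_def)
    ultimately show "pmf ?R x = pmf ?R' x"
      unfolding R R' by (simp add: spmf_run_from_cong)
  qed
  also have "\<dots> \<le> measure_pmf.prob ?R' (fails G')"
  proof (rule measure_pmf.finite_measure_mono)
    \<comment> \<open>An estimate accepted for the value \<open>0\<close> is below
      \<open>\<epsilon> * \<delta>\<close>, which is at most a quarter of the new value. Its error
      there exceeds three quarters of that value, more than the tolerance allowed by
      \<open>\<epsilon> \<le> 1 / 2\<close>.\<close>
    have *: "\<epsilon> * max (ppr \<alpha> G' s t) \<delta> \<le> \<bar>y - ppr \<alpha> G' s t\<bar>" if y: "\<bar>y\<bar> < \<epsilon> * \<delta>" for y
    proof -
      define \<pi> where "\<pi> = ppr \<alpha> G' s t"
      have "4 * (\<epsilon> * \<delta>) \<le> \<pi>" using after by (simp add: \<pi>_def G'_def)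
      moreover have "0 < \<epsilon> * \<delta>" using \<open>0 < \<epsilon>\<close> \<delta> by simp
      moreover have "\<epsilon> * \<pi> \<le> \<pi> / 2"
        using mult_right_mono[OF \<open>\<epsilon> \<le> 1 / 2\<close>, of \<pi>] calculation by simp
      ultimately have "\<epsilon> * \<pi> \<le> \<bar>y - \<pi>\<bar>" "\<epsilon> * \<delta> \<le> \<bar>y - \<pi>\<bar>"
        using y by linarith+
      then show ?thesis
        unfolding \<pi>_def[symmetric] by (simp add: max_def)
    qed
    show "good \<subseteq> fails G'"
      using * before \<delta> by (auto simp: good_def fails_def max_def split: option.splits)
  qed simp
  also have "\<dots> \<le> p"
    using solves G \<delta> walk_digraph_swap_arcs[OF G(1) arcs] adj_lists_of_swap[OF G(1) arcs G(2)]
    unfolding solves_single_target_def fails_def G'_def L'_def by (metis pverts_swap_arcs)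
  finally have "1 / 2 \<le> measure_pmf.prob ?R (Some ` D)"
    using \<open>p \<le> 1 / 4\<close> by simp
  then show ?thesis
    by (simp add: measure_measure_spmf_conv_measure_pmf D_def B_def L'_def)
qed

text \<open>Linearity of expectation: the probabilities of distinguishing the single swaps, each at
  least \<open>1 / 2\<close>, add up to the expected number of distinguished swaps, which the number
  of queries bounds pointwise. A run that may fail to terminate has infinite expected time.\<close>

lemma expected_time_ge:
  assumes solves: "solves_single_target \<alpha> \<epsilon> p A" and \<epsilon>: "0 < \<epsilon>" "\<epsilon> \<le> 1 / 2" and p: "p \<le> 1 / 4"
    and G: "walk_digraph G" "adj_lists_of L G" "t \<in> pverts G"
    and \<delta>: "0 < \<delta>" "\<delta> \<le> 1"
    and sz: "(s, z) \<in> parcs G" and t: "t \<notin> {s, z}"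
    and closed: "\<And>x y. (x, y) \<in> parcs G \<Longrightarrow> x \<in> {s, z} \<longleftrightarrow> y \<in> {s, z}"
    and before: "ppr \<alpha> G s t = 0"
    and E: "E \<subseteq> parcs G" "\<And>u w. (u, w) \<in> E \<Longrightarrow> u \<notin> {s, z}"
    and after: "\<And>u w. (u, w) \<in> E \<Longrightarrow> 4 * \<epsilon> * \<delta> \<le> ppr \<alpha> (swap_arcs G u w s z) s t"
  shows "ennreal (real (card E) / 2) \<le> expected_time A G L t \<delta>"
proof (cases "lossless_spmf (run A G L t \<delta>)")
  case False
  then show ?thesis by (simp add: expected_time_def)
next
  case True
  define B where "B = A (pverts G) (card (parcs G)) t \<delta>"
  define D where "D e = {(f :: nat \<Rightarrow> real, h). distinguishes L (swap_lists L (fst e) (snd e) s z) t B h}" for e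
  let ?M = "measure_spmf (run A G L t \<delta>)"
  have fin: "finite E"
    using E(1) G(1) finite_subset
    by (auto simp: walk_digraph_def pair_fin_digraph_def pair_fin_digraph_axioms_def)
  have s: "s \<in> pverts G"
    using G(1) sz by (auto simp: walk_digraph_def pair_fin_digraph_def intro: pair_wf_digraph.in_arcsD1)
  have ge: "ennreal (1 / 2) \<le> emeasure ?M (D e)" if "e \<in> E" for e
  proof -
    obtain u w where e: "e = (u, w)" by (cases e)
    \<comment> \<open>Neither new arc is present beforehand, since each would join
      \<open>{s, z}\<close> to its complement.\<close>
    have "(u, w) \<in> parcs G" "(u, z) \<notin> parcs G" "(s, w) \<notin> parcs G"
      using that E closed e by blast+
    then have "1 / 2 \<le> measure ?M (D e)"
      using prob_distinguishes_swap_ge[OF solves \<epsilon> p G s \<delta> _ sz _ _ before _ True] after that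
      by (simp add: D_def B_def e)
    then show ?thesis
      unfolding measure_spmf.emeasure_eq_measure by (rule ennreal_leI)
  qed
  have "ennreal (real (card E) / 2) = (\<Sum>e\<in>E. ennreal (1 / 2))"
    by (subst sum_ennreal) simp_all
  also have "\<dots> \<le> (\<Sum>e\<in>E. emeasure ?M (D e))"
    by (intro sum_mono ge)
  also have "\<dots> = (\<integral>\<^sup>+x. (\<Sum>e\<in>E. indicator (D e) x) \<partial>?M)"
    by (subst nn_integral_sum) auto
  also have "\<dots> \<le> (\<integral>\<^sup>+(f, h). of_nat (num_queries h) \<partial>?M)"
  proof (rule nn_integral_mono_AE, subst AE_measure_spmf_iff, rule ballI)
    fix x assume "x \<in> set_spmf (run A G L t \<delta>)"
    moreover obtain f h where x: "x = (f, h)" by (cases x)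
    ultimately have "\<And>i. i < length h \<Longrightarrow> valid_step L t B h i"
      using set_spmf_run_from[of L t B "[]"] by (auto simp: run_def B_def)
    then have "card {e \<in> E. distinguishes L (swap_lists L (fst e) (snd e) s z) t B h} \<le> num_queries h"
      using card_distinguished_swaps_le[OF G t closed] by blast
    moreover have "(\<Sum>e\<in>E. indicator (D e) x) =
        (of_nat (card {e \<in> E. distinguishes L (swap_lists L (fst e) (snd e) s z) t B h}) :: ennreal)"
      using fin by (simp add: D_def x indicator_def sum.If_cases Int_def)
    ultimately show "(\<Sum>e\<in>E. indicator (D e) x) \<le> (case x of (f, h) \<Rightarrow> (of_nat (num_queries h) :: ennreal))"
      by (simp add: x)
  qed
  finally show ?thesis
    using True by (simp add: expected_time_def)
qed

section \<open>The hard graph\<close>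

text \<open>
  Nodes \<open>U l\<close> and \<open>W j\<close> form a complete bipartite graph. The \<open>W j\<close> with \<open>j mod q = g\<close> all point
  to the hub \<open>H g\<close>, which points to the targets \<open>T i\<close> with \<open>i mod q = g\<close>; residue classes are used
  instead of consecutive blocks so that every class has between \<open>k\<close> and \<open>2 * k\<close> elements when
  \<open>q = n div k\<close>. The component \<open>{S, Z}\<close> is invisible from the targets.
\<close>

datatype gadget_node = U nat | W nat | H nat | T nat | S | Z

instance gadget_node :: countable
  by countable_datatype

definition gadget_verts :: "nat \<Rightarrow> nat \<Rightarrow> nat \<Rightarrow> gadget_node set" where
  "gadget_verts n d q = U ` {..<d} \<union> W ` {..<n} \<union> H ` {..<q} \<union> T ` {..<n} \<union> {S, Z}"

definition gadget_arcs :: "nat \<Rightarrow> nat \<Rightarrow> nat \<Rightarrow> (gadget_node \<times> gadget_node) set" where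
  "gadget_arcs n d q = U ` {..<d} \<times> W ` {..<n} \<union> (\<lambda>j. (W j, H (j mod q))) ` {..<n} \<union>
     (\<lambda>j. (H (j mod q), T j)) ` {..<n} \<union> (\<lambda>j. (T j, T j)) ` {..<n} \<union> {(S, Z), (Z, Z)}"

definition gadget :: "nat \<Rightarrow> nat \<Rightarrow> nat \<Rightarrow> nat pair_pre_digraph" where
  "gadget n d q = \<lparr>pverts = to_nat ` gadget_verts n d q,
     parcs = map_prod to_nat to_nat ` gadget_arcs n d q\<rparr>"

lemma pverts_gadget: "pverts (gadget n d q) = to_nat ` gadget_verts n d q"
  and parcs_gadget: "parcs (gadget n d q) = map_prod to_nat to_nat ` gadget_arcs n d q"
  by (simp_all add: gadget_def)

lemma gadget_arcs_iff:
  "(x, y) \<in> gadget_arcs n d q \<longleftrightarrow>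
     (case x of
        U l \<Rightarrow> l < d \<and> (\<exists>j<n. y = W j)
      | W j \<Rightarrow> j < n \<and> y = H (j mod q)
      | H g \<Rightarrow> \<exists>j<n. g = j mod q \<and> y = T j
      | T j \<Rightarrow> j < n \<and> y = T j
      | S \<Rightarrow> y = Z
      | Z \<Rightarrow> y = Z)"
  by (cases x) (auto simp: gadget_arcs_def)

lemma gadget_arc_iff [simp]:
  "(to_nat x, to_nat y) \<in> parcs (gadget n d q) \<longleftrightarrow> (x, y) \<in> gadget_arcs n d q"
  by (auto simp: parcs_gadget)

lemma gadget_arcE:
  assumes "(a, b) \<in> parcs (gadget n d q)"
  obtains x y where "a = to_nat x" "b = to_nat y" "(x, y) \<in> gadget_arcs n d q"
  using assms by (auto simp: parcs_gadget)

lemma out_gadget: "{v. (to_nat x, v) \<in> parcs (gadget n d q)} = to_nat ` {y. (x, y) \<in> gadget_arcs n d q}"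
  by (auto simp: parcs_gadget)

lemma finite_gadget_verts: "finite (gadget_verts n d q)"
  by (simp add: gadget_verts_def)

lemma finite_gadget_arcs: "finite (gadget_arcs n d q)"
  by (simp add: gadget_arcs_def)

lemma walk_digraph_gadget:
  assumes "0 < n" "0 < q" "q \<le> n"
  shows "walk_digraph (gadget n d q)"
proof -
  have "\<exists>y. (x, y) \<in> gadget_arcs n d q" if "x \<in> gadget_verts n d q" for x
  proof (cases x)
    \<comment> \<open>By \<open>q \<le> n\<close> the target \<open>T g\<close> exists and lies in
      the class of hub \<open>H g\<close>.\<close>
    case (H g)
    then have "(H (g mod q), T g) \<in> gadget_arcs n d q" "g mod q = g"
      using that assms by (auto simp: gadget_verts_def gadget_arcs_def)
    then show ?thesis using H by auto
  qed (use that assms in \<open>auto simp: gadget_verts_def gadget_arcs_iff intro!: exI[of _ "0::nat"]\<close>)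
  then have "\<forall>u\<in>pverts (gadget n d q). \<exists>v. (u, v) \<in> parcs (gadget n d q)"
    unfolding pverts_gadget by (metis gadget_arc_iff imageE)
  moreover have "fst e \<in> gadget_verts n d q \<and> snd e \<in> gadget_verts n d q" if "e \<in> gadget_arcs n d q" for e
    using that assms by (auto simp: gadget_verts_def gadget_arcs_def)
  then have "pair_fin_digraph (gadget n d q)"
    unfolding pair_fin_digraph_def pair_wf_digraph_def pair_fin_digraph_axioms_def
    by (auto simp: pverts_gadget parcs_gadget finite_gadget_verts finite_gadget_arcs)
  ultimately show ?thesis
    by (auto simp: walk_digraph_def pverts_gadget gadget_verts_def)
qed

lemma card_pverts_gadget: "card (pverts (gadget n d q)) = d + 2 * n + q + 2"
proof -
  have "card (gadget_verts n d q) = d + 2 * n + q + 2"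
    unfolding gadget_verts_def
    by (subst card_Un_disjoint; (auto simp: card_image inj_on_def)[1])+
  then show ?thesis by (simp add: pverts_gadget card_image)
qed

lemma card_parcs_gadget: "card (parcs (gadget n d q)) = d * n + 3 * n + 2"
proof -
  have "card (gadget_arcs n d q) = d * n + 3 * n + 2"
    unfolding gadget_arcs_def
    by (subst card_Un_disjoint; (auto simp: card_image inj_on_def card_cartesian_product)[1])+
  moreover have "inj_on (map_prod to_nat to_nat) (gadget_arcs n d q)"
    by (auto simp: inj_on_def)
  ultimately show ?thesis by (simp add: parcs_gadget card_image)
qed

section \<open>Sizes of residue classes\<close>

text \<open>Members of one class are told apart by their quotients by \<open>q\<close>, and these
  are below \<open>k\<close>.\<close>

lemma card_residue_class_le:
  assumes "n \<le> q * k"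
  shows "card {i. i < n \<and> i mod q = g} \<le> (k::nat)"
proof -
  have "card {i. i < n \<and> i mod q = g} = card ((\<lambda>i. i div q) ` {i. i < n \<and> i mod q = g})"
    by (intro card_image[symmetric] inj_onI) (metis (mono_tags) mem_Collect_eq mult_div_mod_eq)
  also have "\<dots> \<le> card {..<k}"
  proof (intro card_mono subsetI; clarsimp)
    fix i assume "i < n"
    then show "i div q < k" using assms by (simp add: less_mult_imp_div_less mult.commute)
  qed
  finally show ?thesis by simp
qed

text \<open>The \<open>k\<close> numbers \<open>g + q * j\<close> with \<open>j < k\<close> all
  belong to the class.\<close>

lemma card_residue_class_ge:
  assumes "q * k \<le> n" "g < q"
  shows "k \<le> card {i. i < n \<and> i mod q = (g::nat)}"
proof -
  have "g + q * j < n" if "j < k" for j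
  proof -
    have "g + q * j < q * Suc j" using assms by simp
    also have "\<dots> \<le> q * k" using that by (intro mult_le_mono2) simp
    finally show ?thesis using assms by simp
  qed
  then have "(\<lambda>j. g + q * j) ` {..<k} \<subseteq> {i. i < n \<and> i mod q = g}"
    using assms by auto
  from card_mono[OF _ this] show ?thesis
    using assms by (simp add: card_image inj_on_def)
qed

section \<open>Values of \<open>ppr\<close> before and after a swap, and the cost of a single
  target\<close>

text \<open>The only arc from \<open>Z\<close> is its loop, so its value \<open>x\<close> satisfies
  \<open>x = (1 - \<alpha>) * x\<close> and is \<open>0\<close>; the only arc from \<open>S\<close>
  goes to \<open>Z\<close>.\<close>

lemma ppr_gadget_S:
  assumes "0 < \<alpha>" "\<alpha> < 1"
  shows "ppr \<alpha> (gadget n d q) (to_nat S) (to_nat (T i)) = 0"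
proof -
  let ?G = "gadget n d q"
  have NZ: "{v. (to_nat Z, v) \<in> parcs ?G} = {to_nat Z}"
    and NS: "{v. (to_nat S, v) \<in> parcs ?G} = {to_nat Z}"
    by (auto simp: out_gadget gadget_arcs_iff)
  have "ppr \<alpha> ?G (to_nat Z) (to_nat (T i)) = (1 - \<alpha>) * ppr \<alpha> ?G (to_nat Z) (to_nat (T i))"
    using assms by (intro ppr_single_out[OF _ _ NZ]) auto
  moreover have "ppr \<alpha> ?G (to_nat S) (to_nat (T i)) = (1 - \<alpha>) * ppr \<alpha> ?G (to_nat Z) (to_nat (T i))"
    using assms by (intro ppr_single_out[OF _ _ NS]) auto
  ultimately show ?thesis using assms by (auto simp: algebra_simps)
qed

text \<open>The swap opens the path from \<open>S\<close> through \<open>W j\<close> and the hub of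
  \<open>i\<close> to \<open>T i\<close>. Its three steps cost \<open>(1 - \<alpha>) ^ 3\<close>,
  the hub selects \<open>T i\<close> with probability at least \<open>1 / k\<close>, and the walk
  ends there with probability at least \<open>\<alpha>\<close>.\<close>

lemma ppr_swapped_gadget_S:
  fixes k :: nat
  assumes "0 < \<alpha>" "\<alpha> < 1" "j < n" "i < n" "j mod q = i mod q" "n \<le> q * k" "0 < k"
  shows "\<alpha> * (1 - \<alpha>) ^ 3 / k \<le>
    ppr \<alpha> (swap_arcs (gadget n d q) (to_nat (U l)) (to_nat (W j)) (to_nat S) (to_nat Z))
      (to_nat S) (to_nat (T i))"
proof -
  let ?G = "swap_arcs (gadget n d q) (to_nat (U l)) (to_nat (W j)) (to_nat S) (to_nat Z)"
  let ?ppr = "\<lambda>x. ppr \<alpha> ?G (to_nat x) (to_nat (T i))"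
  have NS: "{v. (to_nat S, v) \<in> parcs ?G} = {to_nat (W j)}"
    and NW: "{v. (to_nat (W j), v) \<in> parcs ?G} = {to_nat (H (i mod q))}"
    and NT: "{v. (to_nat (T i), v) \<in> parcs ?G} = {to_nat (T i)}"
    and NH: "{v. (to_nat (H (i mod q)), v) \<in> parcs ?G} = (to_nat \<circ> T) ` {i'. i' < n \<and> i' mod q = i mod q}"
    using assms by (auto simp: parcs_swap_arcs gadget_arcs_iff elim!: gadget_arcE)
  let ?N = "card {v. (to_nat (H (i mod q)), v) \<in> parcs ?G}"
  have "?N \<le> card {i'. i' < n \<and> i' mod q = i mod q}"
    unfolding NH by (rule card_image_le) simp
  then have N: "?N \<le> k"
    using card_residue_class_le[OF assms(6)] le_trans by blast
  have finN: "finite {v. (to_nat (H (i mod q)), v) \<in> parcs ?G}"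
    and inN: "to_nat (T i) \<in> {v. (to_nat (H (i mod q)), v) \<in> parcs ?G}"
    using assms unfolding NH by auto
  have N0: "0 < ?N" using finN inN by (auto simp only: card_gt_0_iff)
  have "\<alpha> \<le> ?ppr (T i)"
    using assms NT by (intro ppr_self_ge) auto
  then have "\<alpha> / k \<le> ?ppr (T i) / ?N"
    using N N0 assms by (intro frac_le) (auto simp: ppr_nonneg)
  then have "(1 - \<alpha>) * (\<alpha> / k) \<le> (1 - \<alpha>) * (?ppr (T i) / ?N)"
    using assms by (intro mult_left_mono) auto
  also have "\<dots> \<le> ?ppr (H (i mod q))"
    using assms finN inN by (intro ppr_step_ge) auto
  finally have "(1 - \<alpha>) * ((1 - \<alpha>) * ((1 - \<alpha>) * (\<alpha> / k))) \<le> (1 - \<alpha>) * ((1 - \<alpha>) * ?ppr (H (i mod q)))"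
    using assms by (intro mult_left_mono) auto
  also have "(1 - \<alpha>) * ?ppr (H (i mod q)) = ?ppr (W j)"
    using assms NW by (intro ppr_single_out[symmetric]) auto
  also have "(1 - \<alpha>) * ?ppr (W j) = ?ppr S"
    using assms NS by (intro ppr_single_out[symmetric]) auto
  finally show ?thesis by (simp add: power3_eq_cube mult_ac)
qed

lemma expected_time_gadget_ge:
  fixes \<alpha> \<epsilon> p \<delta> :: real and k :: nat
  assumes \<alpha>: "0 < \<alpha>" "\<alpha> < 1" and \<epsilon>: "0 < \<epsilon>" "\<epsilon> \<le> \<alpha> * (1 - \<alpha>) ^ 3 / 8" and p: "p \<le> 1 / 4"
    and \<delta>: "0 < \<delta>" "\<delta> \<le> 1"
    and q: "q * k \<le> n" "n \<le> q * (2 * k)" "0 < q" "0 < k" and k: "k * \<delta> \<le> 1"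
    and i: "i < n"
    and solves: "solves_single_target \<alpha> \<epsilon> p A" and L: "adj_lists_of L (gadget n d q)"
  shows "ennreal (k * d / 2) \<le> expected_time A (gadget n d q) L (to_nat (T i)) \<delta>"
proof -
  define J where "J = {j. j < n \<and> j mod q = i mod q}"
  \<comment> \<open>All arcs into those \<open>W j\<close> that share the hub of \<open>T i\<close>:
    at least \<open>k\<close> heads with \<open>d\<close> incoming arcs each.\<close>
  define E where "E = (\<lambda>(l, j). (to_nat (U l), to_nat (W j))) ` ({..<d} \<times> J)"
  have "q \<le> q * k" using q by simp
  then have "q \<le> n" using q(1) by (rule le_trans)
  have "(1 - \<alpha>) ^ 3 \<le> 1" using \<alpha> by (intro power_le_one) auto
  then have "\<alpha> * (1 - \<alpha>) ^ 3 \<le> 1 * 1" using \<alpha> by (intro mult_mono) auto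
  then have "\<epsilon> \<le> 1 / 2" using \<epsilon> by simp
  have "card E = d * card J"
    unfolding E_def by (subst card_image) (auto simp: inj_on_def card_cartesian_product)
  moreover have "k \<le> card J"
    unfolding J_def using q by (intro card_residue_class_ge) auto
  ultimately have "k * d \<le> card E" by simp
  then have "real (k * d) \<le> real (card E)" by (rule of_nat_mono)
  then have "ennreal (k * d / 2) \<le> ennreal (card E / 2)"
    by (intro ennreal_leI) simp
  also have "\<dots> \<le> expected_time A (gadget n d q) L (to_nat (T i)) \<delta>"
  proof (rule expected_time_ge[OF solves \<epsilon>(1) \<open>\<epsilon> \<le> 1 / 2\<close> p _ L _ \<delta>])
    show "walk_digraph (gadget n d q)"
      using i q \<open>q \<le> n\<close> by (intro walk_digraph_gadget) auto
    show "to_nat (T i) \<in> pverts (gadget n d q)"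
      using i by (auto simp: pverts_gadget gadget_verts_def)
    show "(to_nat S, to_nat Z) \<in> parcs (gadget n d q)"
      by (simp add: gadget_arcs_def)
    show "to_nat (T i) \<notin> {to_nat S, to_nat Z}" by simp
    show "x \<in> {to_nat S, to_nat Z} \<longleftrightarrow> y \<in> {to_nat S, to_nat Z}"
      if "(x, y) \<in> parcs (gadget n d q)" for x y
      using that by (auto elim!: gadget_arcE simp: gadget_arcs_def)
    show "ppr \<alpha> (gadget n d q) (to_nat S) (to_nat (T i)) = 0"
      by (rule ppr_gadget_S[OF \<alpha>])
    show "E \<subseteq> parcs (gadget n d q)"
      by (auto simp: E_def J_def gadget_arcs_def)
    show "u \<notin> {to_nat S, to_nat Z}" if "(u, w) \<in> E" for u w
      using that by (auto simp: E_def)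
    show "4 * \<epsilon> * \<delta> \<le> ppr \<alpha> (swap_arcs (gadget n d q) u w (to_nat S) (to_nat Z)) (to_nat S) (to_nat (T i))"
      if uwE: "(u, w) \<in> E" for u w
    proof -
      obtain l j where uw: "u = to_nat (U l)" "w = to_nat (W j)" and j: "j < n" "j mod q = i mod q"
        using uwE by (auto simp: E_def J_def)
      \<comment> \<open>The \<open>8\<close> in the bound on \<open>\<epsilon>\<close> is the factor
        \<open>4\<close> required of the swapped value times the \<open>2\<close> from hubs of
        out-degree up to \<open>2 * k\<close>.\<close>
      have "4 * \<epsilon> * \<delta> \<le> \<alpha> * (1 - \<alpha>) ^ 3 / 2 * \<delta>"
        using \<epsilon> \<delta> by (intro mult_right_mono) auto
      also have "\<dots> \<le> \<alpha> * (1 - \<alpha>) ^ 3 / 2 * (1 / k)"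
        using \<alpha> k q by (intro mult_left_mono) (auto simp: field_simps)
      also have "\<dots> = \<alpha> * (1 - \<alpha>) ^ 3 / (2 * k)" by simp
      finally show ?thesis
        using ppr_swapped_gadget_S[OF \<alpha> j(1) i j(2) q(2), of d l] q unfolding uw by simp
    qed
  qed
  finally show ?thesis .
qed

section \<open>Choice of parameters and averaging over all targets\<close>

theorem theorem5p6:
  fixes \<alpha> :: real
  assumes "0 < \<alpha>" and "\<alpha> < 1"
  shows "\<exists>\<epsilon>\<^sub>0>0. \<exists>p\<^sub>0>0. \<forall>\<epsilon> p. 0 < \<epsilon> \<and> \<epsilon> \<le> \<epsilon>\<^sub>0 \<and> 0 < p \<and> p \<le> p\<^sub>0 \<longrightarrow>
    (\<exists>c>0. \<exists>C>0. \<forall>(n::nat) (m::nat) \<delta>::real.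
       1 \<le> n \<and> n \<le> m \<and> m \<le> n ^ 2 \<and> 0 < \<delta> \<and> \<delta> \<le> 1 \<longrightarrow>
       (\<exists>G. walk_digraph G \<and>
          c * real n \<le> real (card (pverts G)) \<and> real (card (pverts G)) \<le> C * real n \<and>
          c * real m \<le> real (card (parcs G)) \<and> real (card (parcs G)) \<le> C * real m \<and>
          (\<forall>L. adj_lists_of L G \<longrightarrow>
             (\<forall>A. solves_single_target \<alpha> \<epsilon> p A \<longrightarrow>
                (\<Sum>t\<in>pverts G. expected_time A G L t \<delta>) / of_nat (card (pverts G))
                  \<ge> ennreal (c * min (real m) ((real m / real n) / \<delta>))))))"
proof -
  have graph_exists: "\<exists>G. walk_digraph G \<and>
      1 / 48 * real n \<le> card (pverts G) \<and> card (pverts G) \<le> 6 * real n \<and>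
      1 / 48 * real m \<le> card (parcs G) \<and> card (parcs G) \<le> 6 * real m \<and>
      (\<forall>L. adj_lists_of L G \<longrightarrow>
         (\<forall>A. solves_single_target \<alpha> \<epsilon> p A \<longrightarrow>
            (\<Sum>t\<in>pverts G. expected_time A G L t \<delta>) / of_nat (card (pverts G))
              \<ge> ennreal (1 / 48 * min (real m) ((real m / real n) / \<delta>))))"
    if \<epsilon>: "0 < \<epsilon>" "\<epsilon> \<le> \<alpha> * (1 - \<alpha>) ^ 3 / 8" and p: "p \<le> 1 / 4"
      and n: "1 \<le> n" and nm: "n \<le> m" "m \<le> n ^ 2" and \<delta>: "0 < \<delta>" "\<delta> \<le> 1"
    for \<epsilon> p \<delta> :: real and n m :: nat
  proof -
    define d where "d = m div n"
    \<comment> \<open>About \<open>1 / \<delta>\<close> targets per hub make the swapped value of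
      order \<open>\<delta>\<close>. There are only \<open>n\<close> targets, and this cap produces
      the alternative \<open>m\<close> in the minimum.\<close>
    define k where "k = min n (nat \<lfloor>1 / \<delta>\<rfloor>)"
    define q where "q = n div k"
    have d1: "1 \<le> d" using n nm by (simp add: d_def div_greater_zero_iff Suc_le_eq)
    have dn: "d * n \<le> m" by (simp add: d_def)
    have "d \<le> n ^ 2 div n" unfolding d_def using nm(2) by (rule div_le_mono)
    then have "d \<le> n" using n by (simp add: power2_eq_square)
    have "m < (d + 1) * n" using n by (simp add: d_def dividend_less_div_times)
    also have "\<dots> \<le> 2 * d * n" using d1 by (intro mult_right_mono) auto
    finally have md: "m \<le> 2 * (d * n)" by simp

    have fl: "1 \<le> \<lfloor>1 / \<delta>\<rfloor>" using \<delta> by (simp add: le_floor_iff)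
    then have k1: "1 \<le> k" using n unfolding k_def by linarith
    have "real k \<le> real_of_int \<lfloor>1 / \<delta>\<rfloor>" using fl unfolding k_def by linarith
    also have "\<dots> \<le> 1 / \<delta>" by simp
    finally have k\<delta>: "k * \<delta> \<le> 1" using \<delta> by (simp add: field_simps)
    have "1 / \<delta> < real_of_int \<lfloor>1 / \<delta>\<rfloor> + 1" by linarith
    moreover have "1 / (2 * \<delta>) = (1 / \<delta>) / 2" by simp
    ultimately have "1 / (2 * \<delta>) \<le> real_of_int \<lfloor>1 / \<delta>\<rfloor>" using fl by linarith
    then have k_ge: "min (real n) (1 / (2 * \<delta>)) \<le> k"
      using fl unfolding k_def by linarith
    have "k \<le> n" by (simp add: k_def)
    then have q1: "1 \<le> q" using k1 by (simp add: q_def div_greater_zero_iff Suc_le_eq)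
    have qk: "q * k \<le> n" by (simp add: q_def)
    have "n < (q + 1) * k" using k1 by (simp add: q_def dividend_less_div_times)
    also have "\<dots> \<le> (2 * q) * k" using q1 by (intro mult_right_mono) auto
    finally have nq: "n \<le> q * (2 * k)" by (simp add: mult_ac)
    have "q \<le> n" by (simp add: q_def)

    \<comment> \<open>Rounding loses a factor \<open>2\<close> in \<open>k\<close> and another in
      \<open>d\<close>, so the minimum is at most \<open>4 * k * d\<close>. With the
      \<open>12\<close> from averaging this gives \<open>48\<close>.\<close>
    have "min (real m) (m / n / \<delta>) = min (real n) (1 / \<delta>) * (m / n)"
      using n by (subst min_mult_distrib_right) (simp add: field_simps)
    also have "\<dots> \<le> (2 * min (real n) (1 / (2 * \<delta>))) * (2 * real d)"
    proof (rule mult_mono)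
      show "min (real n) (1 / \<delta>) \<le> 2 * min (real n) (1 / (2 * \<delta>))"
        by (simp add: min_def)
      show "m / n \<le> 2 * real d"
        using of_nat_mono[OF md, where 'a = real] n by (simp add: field_simps)
    qed (use \<delta> in auto)
    also have "\<dots> \<le> (2 * real k) * (2 * real d)"
      using k_ge by (intro mult_right_mono) auto
    finally have min_le: "1 / 48 * min (real m) (m / n / \<delta>) \<le> k * d / 12"
      by simp

    let ?G = "gadget n d q"
    have V: "card (pverts ?G) = d + 2 * n + q + 2" by (rule card_pverts_gadget)
    then have V0: "0 < real (card (pverts ?G))" by simp
    have V6: "card (pverts ?G) \<le> 6 * n" using V \<open>d \<le> n\<close> \<open>q \<le> n\<close> n by simp
    have "ennreal (1 / 48 * min (real m) (m / n / \<delta>))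
        \<le> (\<Sum>t\<in>pverts ?G. expected_time A ?G L t \<delta>) / of_nat (card (pverts ?G))"
      if L: "adj_lists_of L ?G" and A: "solves_single_target \<alpha> \<epsilon> p A" for L A
    proof -
      \<comment> \<open>Only the \<open>n\<close> targets \<open>T i\<close> are counted, each with
        cost at least \<open>k * d / 2\<close>; dividing by at most \<open>6 * n\<close> nodes
        leaves \<open>k * d / 12\<close>.\<close>
      have "(k * d / 12) * card (pverts ?G) \<le> (k * d / 12) * real (6 * n)"
        using V6 by (intro mult_left_mono) (auto simp del: of_nat_mult)
      then have "ennreal (k * d / 12 * card (pverts ?G)) \<le> ennreal (\<Sum>i<n. k * d / 2)"
        by (intro ennreal_leI) (simp add: mult_ac)
      also have "\<dots> = (\<Sum>i<n. ennreal (k * d / 2))"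
        by (subst sum_ennreal) simp_all
      also have "\<dots> \<le> (\<Sum>i<n. expected_time A ?G L (to_nat (T i)) \<delta>)"
        using q1 k1 by (intro sum_mono expected_time_gadget_ge[OF assms \<epsilon> p \<delta> qk nq _ _ k\<delta> _ A L]) auto
      also have "\<dots> = (\<Sum>t\<in>(to_nat \<circ> T) ` {..<n}. expected_time A ?G L t \<delta>)"
        by (subst sum.reindex) (auto simp: inj_on_def)
      also have "\<dots> \<le> (\<Sum>t\<in>pverts ?G. expected_time A ?G L t \<delta>)"
        by (intro sum_mono2) (auto simp: pverts_gadget gadget_verts_def)
      finally have *: "ennreal (k * d / 12 * card (pverts ?G))
          \<le> (\<Sum>t\<in>pverts ?G. expected_time A ?G L t \<delta>)" .
      have "ennreal (1 / 48 * min (real m) (m / n / \<delta>)) \<le> ennreal (k * d / 12)"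
        by (rule ennreal_leI[OF min_le])
      also have "\<dots> = ennreal (k * d / 12 * card (pverts ?G)) / ennreal (card (pverts ?G))"
        using V0 by (subst divide_ennreal) auto
      also have "\<dots> \<le> (\<Sum>t\<in>pverts ?G. expected_time A ?G L t \<delta>) / ennreal (card (pverts ?G))"
        by (rule divide_right_mono_ennreal[OF *])
      finally show ?thesis by (simp add: ennreal_of_nat_eq_real_of_nat)
    qed
    moreover have "walk_digraph ?G"
      using n q1 \<open>q \<le> n\<close> by (intro walk_digraph_gadget) auto
    moreover have "real n \<le> 48 * card (pverts ?G)" using V by simp
    moreover have "real (card (pverts ?G)) \<le> 6 * real n"
      using of_nat_mono[OF V6, where 'a = real] by simp
    moreover have "m \<le> 48 * card (parcs ?G)" "card (parcs ?G) \<le> 6 * m"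
      using md dn nm n unfolding card_parcs_gadget by simp_all
    then have "real m \<le> 48 * card (parcs ?G)" "card (parcs ?G) \<le> 6 * real m"
      by linarith+
    ultimately show ?thesis by (intro exI[of _ ?G]) auto
  qed
  have pos: "0 < \<alpha> * (1 - \<alpha>) ^ 3 / 8" using assms by simp
  show ?thesis
    by (rule exI, rule conjI[OF pos], rule exI[of _ "1 / 4"], rule conjI, simp, intro allI impI,
        elim conjE, rule exI[of _ "1 / 48"], rule conjI, simp, rule exI[of _ 6], rule conjI, simp,
        intro allI impI, elim conjE, rule graph_exists; assumption)
qed

end
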